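(* Let $\pi,\tau\in\mathfrak{S}_m$ be in standard form. If $\pi$ and $\tau$ are strongly c-Wilf equivalent, then $\pi_m-\pi_1=\tau_m-\tau_1$.
   Context: $\mathfrak{S}_n$ is the symmetric group on $[n]$, permutations written $\sigma=\sigma_1\cdots\sigma_n$. The standardization $\operatorname{st}(w)$ of a word of distinct integers replaces its smallest entry by 1, the next smallest by 2, etc. For $\pi\in\mathfrak{S}_m$ and $\sigma\in\mathfrak{S}_n$, $\operatorname{Em}(\pi,\sigma)=\{i\in[n-m+1]:\operatorname{st}(\sigma_i\cdots\sigma_{i+m-1})=\pi\}$. Let $a^\pi_{n,k}$ be the number of $\sigma\in\mathfrak{S}_n$ with $|\operatorname{Em}(\pi,\sigma)|=k$. $\pi$ and $\tau$ are strongly c-Wilf equivalent if $a^\pi_{n,k}=a^\tau_{n,k}$ for all $n,k$. A permutation $\pi\in\mathfrak{S}_m$ is in standard form if $\pi_1<\pi_m$ and $\pi_1+\pi_m\le m+1$. *)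

theory Defs
  imports Main
begin

definition is_perm :: "nat \<Rightarrow> nat list \<Rightarrow> bool" where
  "is_perm n p \<longleftrightarrow> length p = n \<and> distinct p \<and> set p = {1..n}"

definition perms :: "nat \<Rightarrow> nat list set" where
  "perms n = {p. is_perm n p}"

definition st :: "nat list \<Rightarrow> nat list" where
  "st w = map (\<lambda>x. card {y \<in> set w. y \<le> x}) w"

definition Em :: "nat list \<Rightarrow> nat list \<Rightarrow> nat set" where
  "Em pi sigma = {i. 1 \<le> i \<and> i + length pi \<le> length sigma + 1 \<and>
      st (take (length pi) (drop (i - 1) sigma)) = pi}"

definition a_count :: "nat list \<Rightarrow> nat \<Rightarrow> nat \<Rightarrow> nat" where
  "a_count pi n k = card {sigma \<in> perms n. card (Em pi sigma) = k}"

definition strongly_cWilf_equiv :: "nat list \<Rightarrow> nat list \<Rightarrow> bool" where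
  "strongly_cWilf_equiv pi tau \<longleftrightarrow> (\<forall>n k. a_count pi n k = a_count tau n k)"

definition standard_form :: "nat list \<Rightarrow> bool" where
  "standard_form p \<longleftrightarrow> hd p < last p \<and> hd p + last p \<le> length p + 1"

end

theory Submission
  imports Defs "HOL-Combinatorics.Multiset_Permutations"
begin

text \<open>By the cluster method, \<open>a_count\<close> determines the number of clusters with given length and given
  number of marked occurrences. Let \<open>m = e + 1\<close>. The only way to cover \<open>k * e + 1\<close> positions with \<open>k\<close>
  marked occurrences in one cluster is to let consecutive ones share exactly one position. Put
  \<open>d = pi ! e - pi ! 0 > 0\<close>. In such a cluster \<open>k * d + 1\<close> entries form an increasing chain, so there are at
  most \<open>fact (k * e + 1) / fact (k * d + 1)\<close> of them; an explicit construction yields at least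
  \<open>fact k ^ (e - d)\<close>. Up to factors exponential in \<open>k\<close> both bounds are \<open>k ^ (k * (e - d))\<close>, so
  the growth rate in \<open>k\<close> determines \<open>d\<close>.\<close>

section \<open>Marked occurrences, placements and clusters\<close>

text \<open>Positions start at 0 here, but at 1 in \<open>Em\<close>.\<close>

definition occurrences :: "nat list \<Rightarrow> nat list \<Rightarrow> nat set" where
  "occurrences p w = {s. s + length p \<le> length w \<and>
     (\<forall>x<length p. \<forall>y<length p. w ! (s + x) < w ! (s + y) \<longleftrightarrow> p ! x < p ! y)}"

text \<open>Inclusion rather than equality: unmarked occurrences are allowed. The alphabet
  \<open>A\<close> is arbitrary so that a word can be cut into two words over complementary
  alphabets.\<close>

definition marked_words :: "nat list \<Rightarrow> nat set \<Rightarrow> nat set \<Rightarrow> nat list set" where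
  "marked_words p A S = {w \<in> permutations_of_set A. S \<subseteq> occurrences p w}"

definition placements :: "nat \<Rightarrow> nat \<Rightarrow> nat \<Rightarrow> nat set set" where
  "placements m n j = {S. S \<subseteq> {s. s + m \<le> n} \<and> card S = j}"

text \<open>The number \<open>l\<close> stands for the cut just before position \<open>l\<close>;
  every marked window must lie on one side of it.\<close>

definition splits :: "nat \<Rightarrow> nat set \<Rightarrow> nat \<Rightarrow> bool" where
  "splits m S l \<longleftrightarrow> (\<forall>s\<in>S. s + m \<le> l \<or> l \<le> s)"

text \<open>With this definition the empty set is a cluster of length 1, so every placement is uniquely a
  concatenation of clusters.\<close>

definition clusters :: "nat \<Rightarrow> nat \<Rightarrow> nat \<Rightarrow> nat set set" where
  "clusters m n j = {S \<in> placements m n j. \<forall>l. 0 < l \<and> l < n \<longrightarrow> \<not> splits m S l}"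

text \<open>The coefficient of \<open>t^j\<close> in the sum of
  \<open>(1 + t)^(number of occurrences)\<close> over all permutations of length
  \<open>n\<close>.\<close>

definition marked_total :: "nat list \<Rightarrow> nat \<Rightarrow> nat \<Rightarrow> nat" where
  "marked_total p n j = (\<Sum>S\<in>placements (length p) n j. card (marked_words p {1..n} S))"

definition cluster_total :: "nat list \<Rightarrow> nat \<Rightarrow> nat \<Rightarrow> nat" where
  "cluster_total p n j = (\<Sum>S\<in>clusters (length p) n j. card (marked_words p {1..n} S))"

section \<open>Consecutive occurrences in terms of order comparisons\<close>

lemma perms_eq_permutations_of_set: "perms n = permutations_of_set {1..n}"
  by (auto simp: perms_def is_perm_def permutations_of_set_def dest: distinct_card)

text \<open>Ranks are counted by positions instead of values, so that words over different alphabets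
  can be compared position by position.\<close>

lemma card_le_index:
  assumes "distinct w" "x < length w"
  shows "card {v \<in> set w. v \<le> w ! x} = card {y. y < length w \<and> w ! y \<le> w ! x}"
proof -
  have "{v \<in> set w. v \<le> w ! x} = (!) w ` {y. y < length w \<and> w ! y \<le> w ! x}"
    by (auto simp: in_set_conv_nth)
  moreover have "inj_on ((!) w) {y. y < length w \<and> w ! y \<le> w ! x}"
    using assms(1) by (auto simp: inj_on_def nth_eq_iff_index_eq)
  ultimately show ?thesis by (simp add: card_image)
qed

lemma length_st: "length (st w) = length w"
  by (simp add: st_def)

lemma rank_strict_mono:
  assumes "finite A"
  shows "strict_mono_on A (\<lambda>x. card {y \<in> A. y \<le> (x::nat)})"
proof (rule strict_mono_onI)
  fix r s assume "r \<in> A" "s \<in> A" "r < s"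
  then have "{y \<in> A. y \<le> r} \<subseteq> {y \<in> A. y \<le> s}" "s \<in> {y \<in> A. y \<le> s} - {y \<in> A. y \<le> r}"
    by auto
  then have "{y \<in> A. y \<le> r} \<subset> {y \<in> A. y \<le> s}" by blast
  then show "card {y \<in> A. y \<le> r} < card {y \<in> A. y \<le> s}"
    using assms by (intro psubset_card_mono) auto
qed

lemma st_less_iff:
  assumes "x < length w" "y < length w"
  shows "st w ! x < st w ! y \<longleftrightarrow> w ! x < w ! y"
  using assms strict_mono_on_less[OF rank_strict_mono[of "set w"], of "w ! x" "w ! y"]
  by (simp add: st_def)

text \<open>An entry of a permutation equals its rank, and ranks depend only on the comparisons
  between entries.\<close>

lemma st_eq_iff:
  assumes p: "p \<in> perms m" and w: "distinct w" "length w = m"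
  shows "st w = p \<longleftrightarrow> (\<forall>x<m. \<forall>y<m. w ! x < w ! y \<longleftrightarrow> p ! x < p ! y)"
proof
  assume "st w = p"
  then show "\<forall>x<m. \<forall>y<m. w ! x < w ! y \<longleftrightarrow> p ! x < p ! y"
    using st_less_iff w by blast
next
  assume same: "\<forall>x<m. \<forall>y<m. w ! x < w ! y \<longleftrightarrow> p ! x < p ! y"
  have lp: "length p = m" and dp: "distinct p" and sp: "set p = {1..m}"
    using p by (auto simp: perms_def is_perm_def)
  show "st w = p"
  proof (rule nth_equalityI)
    show "length (st w) = length p" using lp w by (simp add: length_st)
  next
    fix x assume "x < length (st w)"
    then have x: "x < m" using w by (simp add: length_st)
    have "st w ! x = card {y. y < m \<and> w ! y \<le> w ! x}"
      using x w card_le_index[of w x] by (simp add: st_def)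
    also have "{y. y < m \<and> w ! y \<le> w ! x} = {y. y < m \<and> p ! y \<le> p ! x}"
      using same x by (auto simp: not_less[symmetric])
    also have "card \<dots> = card {v \<in> set p. v \<le> p ! x}"
      using x lp dp card_le_index[of p x] by simp
    also have "{v \<in> set p. v \<le> p ! x} = {1..p ! x}"
      using x lp sp nth_mem[of x p] by auto
    finally show "st w ! x = p ! x" by simp
  qed
qed

lemma Em_eq_Suc_occurrences:
  assumes p: "p \<in> perms m" and w: "distinct w"
  shows "Em p w = Suc ` occurrences p w"
proof -
  have lp: "length p = m"
    using p by (auto simp: perms_def is_perm_def)
  have *: "st (take m (drop s w)) = p \<longleftrightarrow>
      (\<forall>x<m. \<forall>y<m. w ! (s + x) < w ! (s + y) \<longleftrightarrow> p ! x < p ! y)"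
    if "s + m \<le> length w" for s
    using that w by (subst st_eq_iff[OF p]) auto
  have "i \<in> Em p w \<longleftrightarrow> i \<in> Suc ` occurrences p w" for i
    using *[of "i - 1"] lp by (cases i) (auto simp: Em_def occurrences_def)
  then show ?thesis by blast
qed

section \<open>Counting words with marked occurrences\<close>

lemma finite_occurrences: "finite (occurrences p w)"
  by (rule finite_subset[of _ "{..length w}"]) (auto simp: occurrences_def)

lemma finite_marked_words: "finite A \<Longrightarrow> finite (marked_words p A S)"
  by (simp add: marked_words_def)

lemma finite_placements: "finite (placements m n j)"
  by (rule finite_subset[of _ "Pow {..n}"]) (auto simp: placements_def)

lemma finite_clusters: "finite (clusters m n j)"
  by (rule finite_subset[OF _ finite_placements]) (auto simp: clusters_def)

text \<open>Double counting of pairs of a word and a \<open>j\<close>-element set of its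
  occurrences. The right-hand side depends on \<open>p\<close> only through \<open>a_count\<close>;
  this is where strong c-Wilf equivalence enters.\<close>

lemma marked_total_eq_sum_binomial:
  assumes "m > 0" and p: "p \<in> perms m"
  shows "marked_total p n j = (\<Sum>k\<le>n. (k choose j) * a_count p n k)"
proof -
  have lp: "length p = m"
    using p by (auto simp: perms_def is_perm_def)
  have lw: "length w = n" if "w \<in> perms n" for w
    using that by (auto simp: perms_def is_perm_def)
  have dw: "distinct w" if "w \<in> perms n" for w
    using that by (auto simp: perms_def is_perm_def)
  have fin: "finite (perms n)" by (simp add: perms_eq_permutations_of_set)
  have Em_card: "card (Em p w) = card (occurrences p w)" if "w \<in> perms n" for w
    using that by (simp add: Em_eq_Suc_occurrences[OF p] dw card_image)
  \<comment> \<open>Since \<open>m > 0\<close>, occurrences start below \<open>n\<close>; hence the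
    sum over \<open>k \<le> n\<close> misses no word.\<close>
  have occ_bound: "card (occurrences p w) \<le> n" if "w \<in> perms n" for w
  proof -
    have "occurrences p w \<subseteq> {..<n}"
    proof
      fix s assume "s \<in> occurrences p w"
      then have "s + m \<le> n" using lw[OF that] lp by (simp add: occurrences_def)
      then show "s \<in> {..<n}" using \<open>m > 0\<close> by simp
    qed
    then show ?thesis using card_mono[of "{..<n}"] by fastforce
  qed
  have "marked_total p n j
      = (\<Sum>S\<in>placements m n j. \<Sum>w\<in>perms n. if S \<subseteq> occurrences p w then 1 else 0)"
    unfolding marked_total_def lp marked_words_def perms_eq_permutations_of_set[symmetric]
    using fin by (simp add: sum.If_cases Int_def)
  also have "\<dots> = (\<Sum>w\<in>perms n. \<Sum>S\<in>placements m n j. if S \<subseteq> occurrences p w then 1 else 0)"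
    by (rule sum.swap)
  also have "\<dots> = (\<Sum>w\<in>perms n. card (Em p w) choose j)"
  proof (rule sum.cong[OF refl])
    fix w assume w: "w \<in> perms n"
    have "(\<Sum>S\<in>placements m n j. if S \<subseteq> occurrences p w then 1 else 0)
        = card {S \<in> placements m n j. S \<subseteq> occurrences p w}"
      using finite_placements by (simp add: sum.If_cases Int_def)
    also have "{S \<in> placements m n j. S \<subseteq> occurrences p w} = {S. S \<subseteq> occurrences p w \<and> card S = j}"
      using lw[OF w] lp by (auto simp: placements_def occurrences_def)
    also have "card \<dots> = card (Em p w) choose j"
      using w by (simp add: n_subsets finite_occurrences Em_card)
    finally show "(\<Sum>S\<in>placements m n j. if S \<subseteq> occurrences p w then 1 else 0)
        = card (Em p w) choose j" .
  qed
  also have "\<dots> = (\<Sum>k\<le>n. \<Sum>w\<in>{w \<in> perms n. card (Em p w) = k}. card (Em p w) choose j)"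
    using fin occ_bound Em_card by (intro sum.group[symmetric]) auto
  also have "\<dots> = (\<Sum>k\<le>n. (k choose j) * a_count p n k)"
    by (intro sum.cong) (auto simp: a_count_def mult.commute)
  finally show ?thesis .
qed

section \<open>Relabelling and concatenation of marked words\<close>

lemma occurrences_map:
  assumes "strict_mono_on (set w) f"
  shows "occurrences p (map f w) = occurrences p w"
proof -
  have "f (w ! (s + x)) < f (w ! (s + y)) \<longleftrightarrow> w ! (s + x) < w ! (s + y)"
    if "s + length p \<le> length w" "x < length p" "y < length p" for s x y
    using that by (intro strict_mono_on_less[OF assms]) auto
  then show ?thesis
    by (auto simp: occurrences_def)
qed

lemma card_marked_words_image:
  assumes f: "strict_mono_on A f"
  shows "card (marked_words p (f ` A) S) = card (marked_words p A S)"
proof -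
  have inj: "inj_on f A" using f by (rule strict_mono_on_imp_inj_on)
  have "marked_words p (f ` A) S = map f ` marked_words p A S"
  proof (intro equalityI subsetI)
    fix v assume v: "v \<in> marked_words p (f ` A) S"
    define w where "w = map (inv_into A f) v"
    have sv: "set v = f ` A" "distinct v"
      using v by (auto simp: marked_words_def permutations_of_set_def)
    have fw: "map f w = v"
      unfolding w_def map_map by (rule map_idI) (use sv in \<open>auto simp: f_inv_into_f\<close>)
    have sw: "set w = A"
      using sv inj by (auto simp: w_def)
    have "distinct w"
      using sv by (simp add: w_def distinct_map inj_on_inv_into)
    moreover have "occurrences p w = occurrences p v"
      using occurrences_map[of w f] f fw sw by simp
    ultimately have "w \<in> marked_words p A S"
      using v sw by (auto simp: marked_words_def permutations_of_set_def)
    then show "v \<in> map f ` marked_words p A S" using fw by blast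
  next
    fix v assume "v \<in> map f ` marked_words p A S"
    then obtain w where w: "v = map f w" "w \<in> marked_words p A S" by blast
    then show "v \<in> marked_words p (f ` A) S"
      using inj f by (auto simp: marked_words_def permutations_of_set_def distinct_map occurrences_map)
  qed
  moreover have "inj_on (map f) (marked_words p A S)"
    by (rule inj_onI, rule map_inj_on)
      (use inj in \<open>auto simp: marked_words_def permutations_of_set_def\<close>)
  ultimately show ?thesis by (simp add: card_image)
qed

text \<open>The rank function maps \<open>A\<close> increasingly onto \<open>{1..card A}\<close>,
  and increasing relabelling keeps occurrences.\<close>

lemma card_marked_words_standardize:
  assumes "finite A"
  shows "card (marked_words p A S) = card (marked_words p {1..card A} S)"
proof -
  let ?f = "\<lambda>x. card {y \<in> A. y \<le> x}"
  have sm: "strict_mono_on A ?f" using assms by (rule rank_strict_mono)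
  have "?f ` A \<subseteq> {1..card A}"
    using assms by (auto simp: Suc_le_eq card_gt_0_iff intro!: card_mono)
  moreover have "card (?f ` A) = card A"
    using strict_mono_on_imp_inj_on[OF sm] by (rule card_image)
  ultimately have "?f ` A = {1..card A}"
    by (intro card_subset_eq) auto
  then show ?thesis using card_marked_words_image[OF sm, of p S] by simp
qed

text \<open>No marked window crosses the boundary: those from \<open>S\<close> fit into
  \<open>u\<close>, and the shifted ones start after it.\<close>

lemma occurrences_append:
  assumes "length p > 0" and S: "S \<subseteq> {s. s + length p \<le> length u}"
  shows "S \<union> (+) (length u) ` T \<subseteq> occurrences p (u @ v)
    \<longleftrightarrow> S \<subseteq> occurrences p u \<and> T \<subseteq> occurrences p v"
proof -
  have 1: "s \<in> occurrences p (u @ v) \<longleftrightarrow> s \<in> occurrences p u" if "s \<in> S" for s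
    using that S by (auto simp: occurrences_def nth_append)
  have 2: "length u + s \<in> occurrences p (u @ v) \<longleftrightarrow> s \<in> occurrences p v" for s
    by (auto simp: occurrences_def nth_append add.assoc)
  show ?thesis using 1 2 by blast
qed

text \<open>A word corresponds to the set \<open>B\<close> of its first \<open>l\<close> values
  together with a word over \<open>B\<close> and one over the complement. By standardization the
  number of such pairs does not depend on \<open>B\<close>, so the choice of \<open>B\<close>
  contributes the binomial coefficient.\<close>

lemma card_marked_words_Un:
  assumes "length p > 0" "l \<le> n"
    and S: "S \<subseteq> {s. s + length p \<le> l}"
  shows "card (marked_words p {1..n} (S \<union> (+) l ` T))
    = (n choose l) * card (marked_words p {1..l} S) * card (marked_words p {1..n - l} T)"
proof -
  let ?B = "{B. B \<subseteq> {1..n} \<and> card B = l}"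
  let ?X = "\<lambda>B. marked_words p B S \<times> marked_words p ({1..n} - B) T"
  have len: "length w = card B" if "w \<in> marked_words p B U" for w B U
    using that by (auto simp: marked_words_def permutations_of_set_def distinct_card)
  have setw: "set w = B" if "w \<in> marked_words p B U" for w B U
    using that by (auto simp: marked_words_def permutations_of_set_def)
  have "bij_betw (\<lambda>(B, u, v). u @ v) (Sigma ?B ?X) (marked_words p {1..n} (S \<union> (+) l ` T))"
  proof (rule bij_betw_imageI)
    show "inj_on (\<lambda>(B, u, v). u @ v) (Sigma ?B ?X)"
    proof (rule inj_onI)
      fix x y assume "x \<in> Sigma ?B ?X" "y \<in> Sigma ?B ?X"
        and eq: "(case x of (B, u, v) \<Rightarrow> u @ v) = (case y of (B, u, v) \<Rightarrow> u @ v)"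
      then obtain B u v B' u' v' where xy: "x = (B, u, v)" "y = (B', u', v')"
        and u: "u \<in> marked_words p B S" "u' \<in> marked_words p B' S"
        and "card B = l" "card B' = l" by blast
      then have "length u = length u'" by (simp add: len)
      then have "u = u'" "v = v'" using eq xy by auto
      then show "x = y" using setw[OF u(1)] setw[OF u(2)] xy by simp
    qed
    show "(\<lambda>(B, u, v). u @ v) ` Sigma ?B ?X = marked_words p {1..n} (S \<union> (+) l ` T)"
    proof (intro equalityI subsetI)
      fix w assume "w \<in> (\<lambda>(B, u, v). u @ v) ` Sigma ?B ?X"
      then obtain B u v where *: "w = u @ v" "B \<subseteq> {1..n}" "card B = l"
        "u \<in> marked_words p B S" "v \<in> marked_words p ({1..n} - B) T" by auto
      then have "S \<union> (+) l ` T \<subseteq> occurrences p w"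
        using occurrences_append[of p S u T v] assms len[of u B S] by (auto simp: marked_words_def)
      then show "w \<in> marked_words p {1..n} (S \<union> (+) l ` T)"
        using * by (auto simp: marked_words_def permutations_of_set_def)
    next
      fix w assume w: "w \<in> marked_words p {1..n} (S \<union> (+) l ` T)"
      define u v where "u = take l w" and "v = drop l w"
      have wuv: "w = u @ v" by (simp add: u_def v_def)
      have dw: "distinct w" and sw: "set w = {1..n}"
        using w by (auto simp: marked_words_def permutations_of_set_def)
      have "length w = n" using len[OF w] by simp
      then have lu: "length u = l" using assms(2) by (simp add: u_def)
      have sv: "set v = {1..n} - set u" using dw sw wuv by auto
      have cu: "card (set u) = l" using dw wuv lu by (simp add: distinct_card)
      have "S \<subseteq> occurrences p u \<and> T \<subseteq> occurrences p v"
        using w occurrences_append[of p S u T v] assms lu wuv by (auto simp: marked_words_def)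
      then have "u \<in> marked_words p (set u) S \<and> v \<in> marked_words p ({1..n} - set u) T"
        using dw wuv sv by (auto simp: marked_words_def permutations_of_set_def)
      then show "w \<in> (\<lambda>(B, u, v). u @ v) ` Sigma ?B ?X"
        using wuv cu sw by (auto intro!: image_eqI[of _ _ "(set u, u, v)"])
    qed
  qed
  then have "card (marked_words p {1..n} (S \<union> (+) l ` T)) = card (Sigma ?B ?X)"
    by (simp add: bij_betw_same_card)
  also have "\<dots> = (\<Sum>B\<in>?B. card (?X B))"
    by (rule card_SigmaI) (auto intro!: finite_marked_words dest: finite_subset)
  also have "\<dots> = (\<Sum>B\<in>?B. card (marked_words p {1..l} S) * card (marked_words p {1..n - l} T))"
  proof (rule sum.cong[OF refl])
    fix B assume B: "B \<in> ?B"
    then have "finite B" by (auto dest: finite_subset)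
    moreover have "card ({1..n} - B) = n - l"
      using B \<open>finite B\<close> by (simp add: card_Diff_subset)
    ultimately show "card (?X B) = card (marked_words p {1..l} S) * card (marked_words p {1..n - l} T)"
      using B card_marked_words_standardize[of B p S]
        card_marked_words_standardize[of "{1..n} - B" p T]
      by (simp add: card_cartesian_product)
  qed
  also have "\<dots> = (n choose l) * card (marked_words p {1..l} S) * card (marked_words p {1..n - l} T)"
    by (simp add: n_subsets)
  finally show ?thesis .
qed

section \<open>Splitting off the first cluster\<close>

text \<open>This recovers \<open>l\<close> from the union and so makes the decomposition unique. The
  cut at \<open>l\<close> is admissible, and a smaller one would cut the cluster
  \<open>S\<close>.\<close>

lemma least_split_cluster_Un:
  assumes "l > 0" and S: "S \<in> clusters m l i"
  shows "(LEAST l'. 0 < l' \<and> splits m (S \<union> (+) l ` T) l') = l"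
proof (rule Least_equality)
  show "0 < l \<and> splits m (S \<union> (+) l ` T) l"
    using assms by (auto simp: splits_def clusters_def placements_def)
next
  fix l' assume l': "0 < l' \<and> splits m (S \<union> (+) l ` T) l'"
  then have "splits m S l'" by (auto simp: splits_def)
  then show "l \<le> l'" using S l' by (auto simp: clusters_def not_less[symmetric])
qed

text \<open>Cut a placement at its least positive admissible cut \<open>l\<close>: the windows
  before it form a cluster, those after it an arbitrary placement shifted by
  \<open>l\<close>.\<close>

lemma bij_betw_first_cluster:
  assumes "m > 0" "n > 0"
  shows "bij_betw (\<lambda>(l, i, S, T). S \<union> (+) l ` T)
    (SIGMA l:{1..n}. SIGMA i:{..j}. clusters m l i \<times> placements m (n - l) (j - i))
    (placements m n j)" (is "bij_betw ?g ?D _")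
proof (rule bij_betw_imageI)
  have below: "s < l" if "S \<in> clusters m l i" "s \<in> S" for s S l i
  proof -
    have "s + m \<le> l" using that by (auto simp: clusters_def placements_def)
    then show ?thesis using \<open>m > 0\<close> by simp
  qed
  have fin: "finite S" if "S \<in> placements m n j" for S n j
    by (rule finite_subset[of _ "{..n}"]) (use that in \<open>auto simp: placements_def\<close>)
  show "inj_on ?g ?D"
  proof (rule inj_onI)
    fix x y assume "x \<in> ?D" "y \<in> ?D" and g: "?g x = ?g y"
    then obtain l i S T l' i' S' T' where xy: "x = (l, i, S, T)" "y = (l', i', S', T')"
      and l: "l \<in> {1..n}" "l' \<in> {1..n}"
      and S: "S \<in> clusters m l i" "S' \<in> clusters m l' i'" by blast
    then have eq: "S \<union> (+) l ` T = S' \<union> (+) l' ` T'" using g by simp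
    have ll: "l = l'"
      using least_split_cluster_Un[OF _ S(1), of T] least_split_cluster_Un[OF _ S(2), of T'] eq l
      by simp
    \<comment> \<open>Start positions below \<open>l\<close> come from the cluster and the others
      from the shifted placement, so the union and \<open>l\<close> determine both parts.\<close>
    have "S = (S \<union> (+) l ` T) \<inter> {..<l}" "S' = (S' \<union> (+) l' ` T') \<inter> {..<l'}"
      using below[OF S(1)] below[OF S(2)] by auto
    then have SS: "S = S'" using eq ll by simp
    have "T = {t. l + t \<in> S \<union> (+) l ` T}" using below[OF S(1)] by force
    also have "\<dots> = {t. l' + t \<in> S' \<union> (+) l' ` T'}" by (simp only: eq[unfolded ll] ll)
    also have "\<dots> = T'" using below[OF S(2)] by force
    finally have "T = T'" .
    moreover have "i = i'" using S SS by (auto simp: clusters_def placements_def)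
    ultimately show "x = y" using ll SS xy by simp
  qed
  show "?g ` ?D = placements m n j"
  proof (intro equalityI subsetI)
    fix U assume "U \<in> ?g ` ?D"
    then obtain l i S T where *: "U = S \<union> (+) l ` T" "1 \<le> l" "l \<le> n" "i \<le> j"
      "S \<in> clusters m l i" "T \<in> placements m (n - l) (j - i)" by auto
    have Sp: "S \<in> placements m l i" using * by (simp add: clusters_def)
    have "card U = card S + card ((+) l ` T)"
      unfolding *(1) using below[OF *(5)] fin[OF Sp] fin[OF *(6)]
      by (intro card_Un_disjoint) force+
    also have "\<dots> = j" using *(4,6) Sp by (simp add: card_image placements_def)
    finally show "U \<in> placements m n j"
      using * Sp by (auto simp: placements_def)
  next
    fix U assume U: "U \<in> placements m n j"
    define l where "l = (LEAST l. 0 < l \<and> splits m U l)"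
    \<comment> \<open>The cut at \<open>n\<close> lies behind every window, so the least cut exists
      and is at most \<open>n\<close>.\<close>
    have n: "0 < n \<and> splits m U n" using U \<open>n > 0\<close> by (auto simp: splits_def placements_def)
    then have l: "0 < l" "splits m U l" "l \<le> n"
      using LeastI[of "\<lambda>l. 0 < l \<and> splits m U l", OF n]
        Least_le[of "\<lambda>l. 0 < l \<and> splits m U l", OF n] by (auto simp: l_def)
    define S T where "S = U \<inter> {..<l}" and "T = {t. l + t \<in> U}"
    have "x \<in> (+) l ` T" if "x \<in> U" "l \<le> x" for x
      using that by (auto simp: T_def intro!: image_eqI[of _ _ "x - l"])
    then have UST: "U = S \<union> (+) l ` T"
      by (auto simp: S_def T_def not_less[symmetric])
    have finT: "finite T"
      by (rule finite_imageD[of "(+) l"])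
        (use fin[OF U] in \<open>auto simp: T_def intro: finite_subset[of _ U]\<close>)
    have "card U = card S + card ((+) l ` T)"
      by (subst UST, intro card_Un_disjoint) (use fin[OF U] finT in \<open>auto simp: S_def\<close>)
    then have cards: "card S + card T = j" using U by (simp add: card_image placements_def)
    have "S \<in> placements m l (card S)"
      using l(2) by (auto simp: placements_def S_def splits_def)
    \<comment> \<open>A smaller cut of \<open>S\<close> would also be one of \<open>U\<close>, whose
      other windows start at \<open>l\<close> or later; this contradicts minimality.\<close>
    moreover have "\<not> splits m S l'" if "0 < l'" "l' < l" for l'
    proof
      assume "splits m S l'"
      then have "splits m U l'" using that by (auto simp: splits_def S_def not_less)
      then show False
        using not_less_Least[of l' "\<lambda>l. 0 < l \<and> splits m U l"] that by (simp add: l_def)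
    qed
    ultimately have "S \<in> clusters m l (card S)" by (simp add: clusters_def)
    moreover have "T \<in> placements m (n - l) (j - card S)"
      using U cards by (auto simp: placements_def T_def)
    ultimately have "(l, card S, S, T) \<in> ?D" using l cards by auto
    then show "U \<in> ?g ` ?D" using UST by force
  qed
qed

section \<open>Cluster totals are determined by marked totals\<close>

text \<open>Coefficient form of \<open>M = 1 + C * M\<close>, where \<open>M\<close> and
  \<open>C\<close> are the generating functions of marked words and of clusters, exponential in the
  length.\<close>

lemma marked_total_recursion:
  assumes "length p > 0" "n > 0"
  shows "marked_total p n j = (\<Sum>l=1..n. \<Sum>i\<le>j.
    (n choose l) * cluster_total p l i * marked_total p (n - l) (j - i))"
proof -
  let ?m = "length p"
  let ?W = "\<lambda>S. card (marked_words p {1..n} S)"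
  let ?D = "SIGMA l:{1..n}. SIGMA i:{..j}. clusters ?m l i \<times> placements ?m (n - l) (j - i)"
  have "marked_total p n j = (\<Sum>(l, i, S, T)\<in>?D. ?W (S \<union> (+) l ` T))"
    unfolding marked_total_def
    using sum.reindex_bij_betw[OF bij_betw_first_cluster[OF assms], of ?W j]
    by (simp add: case_prod_unfold)
  also have "\<dots> = (\<Sum>l=1..n. \<Sum>i\<le>j. \<Sum>S\<in>clusters ?m l i.
      \<Sum>T\<in>placements ?m (n - l) (j - i). ?W (S \<union> (+) l ` T))"
    by (simp add: sum.Sigma finite_clusters finite_placements)
  also have "\<dots> = (\<Sum>l=1..n. \<Sum>i\<le>j.
      (n choose l) * cluster_total p l i * marked_total p (n - l) (j - i))"
  proof (intro sum.cong refl)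
    fix l i assume "l \<in> {1..n}" "i \<in> {..j}"
    have "(\<Sum>S\<in>clusters ?m l i. \<Sum>T\<in>placements ?m (n - l) (j - i). ?W (S \<union> (+) l ` T))
      = (\<Sum>S\<in>clusters ?m l i. \<Sum>T\<in>placements ?m (n - l) (j - i).
          (n choose l) * (card (marked_words p {1..l} S) * card (marked_words p {1..n - l} T)))"
      using \<open>l \<in> {1..n}\<close> assms(1)
      by (intro sum.cong refl, subst card_marked_words_Un)
        (auto simp: clusters_def placements_def mult.assoc)
    also have "\<dots> = (n choose l) * (cluster_total p l i * marked_total p (n - l) (j - i))"
      unfolding cluster_total_def marked_total_def by (subst sum_product) (simp only: sum_distrib_left)
    finally show "(\<Sum>S\<in>clusters ?m l i. \<Sum>T\<in>placements ?m (n - l) (j - i). ?W (S \<union> (+) l ` T))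
      = (n choose l) * cluster_total p l i * marked_total p (n - l) (j - i)"
      by (simp only: mult.assoc)
  qed
  finally show ?thesis .
qed

lemma marked_total_0:
  assumes "length p > 0"
  shows "marked_total p 0 j = (if j = 0 then 1 else 0)"
proof -
  have "placements (length p) 0 j = (if j = 0 then {{}} else {})"
    using assms by (auto simp: placements_def)
  moreover have "marked_words p {1..0} {} = {[]}"
    by (auto simp: marked_words_def)
  ultimately show ?thesis by (simp add: marked_total_def)
qed

text \<open>The term \<open>l = n\<close> is isolated: the word left after the cluster is empty and
  carries no mark. All other terms involve shorter clusters only.\<close>

lemma marked_total_eq_cluster_total_plus:
  assumes "length p > 0" "n > 0"
  shows "marked_total p n j = cluster_total p n j + (\<Sum>l=1..<n. \<Sum>i\<le>j.
    (n choose l) * cluster_total p l i * marked_total p (n - l) (j - i))"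
proof -
  have "{1..n} = insert n {1..<n}" using assms(2) by auto
  moreover have "(\<Sum>i\<le>j. cluster_total p n i * marked_total p 0 (j - i)) = cluster_total p n j"
  proof -
    have "(\<Sum>i\<le>j. cluster_total p n i * marked_total p 0 (j - i))
        = (\<Sum>i\<le>j. if i = j then cluster_total p n i else 0)"
      by (intro sum.cong) (auto simp: marked_total_0[OF assms(1)])
    then show ?thesis by simp
  qed
  ultimately show ?thesis
    by (simp add: marked_total_recursion[OF assms])
qed

text \<open>Strong induction on the length: the terms with \<open>l < n\<close> agree, hence so does
  the isolated one.\<close>

lemma cluster_total_cong:
  assumes "length p > 0" "length q > 0"
    and eq: "\<And>n j. marked_total p n j = marked_total q n j"
    and "n > 0"
  shows "cluster_total p n j = cluster_total q n j"
  using \<open>n > 0\<close>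
proof (induction n arbitrary: j rule: less_induct)
  case (less n)
  have "(\<Sum>l=1..<n. \<Sum>i\<le>j. (n choose l) * cluster_total p l i * marked_total p (n - l) (j - i))
      = (\<Sum>l=1..<n. \<Sum>i\<le>j. (n choose l) * cluster_total q l i * marked_total q (n - l) (j - i))"
    by (intro sum.cong refl) (simp add: eq less.IH)
  then show ?case
    using marked_total_eq_cluster_total_plus[OF assms(1) less.prems, of j]
      marked_total_eq_cluster_total_plus[OF assms(2) less.prems, of j] eq[of n j] by simp
qed

section \<open>The unique longest cluster with \<open>k\<close> marks\<close>

text \<open>If \<open>k\<close> intervals of length \<open>d\<close> cover \<open>k * d\<close>
  cells, none can overlap. The induction removes the interval that covers the last cell.\<close>

lemma tiling_unique:
  assumes "d > 0" "finite S" "card S = k"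
    and "\<And>l. l < k * d \<Longrightarrow> \<exists>s\<in>S. s \<le> l \<and> l < s + d"
  shows "S = (\<lambda>i. i * d) ` {..<k}"
  using assms(2-)
proof (induction k arbitrary: S)
  case 0
  then show ?case by simp
next
  case (Suc k)
  obtain s where s: "s \<in> S" "Suc k * d - 1 < s + d"
    using Suc.prems(3)[of "Suc k * d - 1"] assms(1) by auto
  \<comment> \<open>The removed interval covers no cell below \<open>k * d\<close>, so the remaining
    ones cover all of these.\<close>
  then have sk: "k * d \<le> s" by simp
  have "\<exists>t\<in>S - {s}. t \<le> l \<and> l < t + d" if "l < k * d" for l
    using Suc.prems(3)[of l] that sk by fastforce
  then have rest: "S - {s} = (\<lambda>i. i * d) ` {..<k}"
    using Suc.prems(1,2) s(1) by (intro Suc.IH) auto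
  obtain t where t: "t \<in> S" "t \<le> k * d" "k * d < t + d"
    using Suc.prems(3)[of "k * d"] assms(1) by auto
  \<comment> \<open>The remaining intervals end before cell \<open>k * d\<close>, so only
    \<open>s\<close> can cover it; this gives \<open>s \<le> k * d\<close>.\<close>
  have "t = s"
  proof (rule ccontr)
    assume "t \<noteq> s"
    then obtain i where i: "i < k" "t = i * d" using t(1) rest by blast
    then have "Suc i * d \<le> k * d" by (intro mult_le_mono1) simp
    then show False using i t(3) by simp
  qed
  then have "S = insert (k * d) ((\<lambda>i. i * d) ` {..<k})" using s(1) sk t(2) rest by auto
  then show ?case by (simp add: lessThan_Suc)
qed

text \<open>A window of length \<open>d + 1\<close> straddles exactly \<open>d\<close> cuts, and in
  a cluster each of the \<open>k * d\<close> inner cuts must be straddled. So the windows induce a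
  tiling of the cuts.\<close>

lemma clusters_sparse:
  assumes "d > 0"
  shows "clusters (Suc d) (Suc (k * d)) k = {(\<lambda>i. i * d) ` {..<k}}"
proof (intro equalityI subsetI)
  fix S assume S: "S \<in> clusters (Suc d) (Suc (k * d)) k"
  have "finite S"
    by (rule finite_subset[of _ "{..k * d}"]) (use S in \<open>auto simp: clusters_def placements_def\<close>)
  moreover have "\<exists>s\<in>S. s \<le> l \<and> l < s + d" if "l < k * d" for l
  proof -
    have "\<not> splits (Suc d) S (Suc l)" using S that by (auto simp: clusters_def)
    then show ?thesis by (auto simp: splits_def not_le less_Suc_eq_le)
  qed
  ultimately have "S = (\<lambda>i. i * d) ` {..<k}"
    using S assms by (intro tiling_unique) (auto simp: clusters_def placements_def)
  then show "S \<in> {(\<lambda>i. i * d) ` {..<k}}" by simp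
next
  fix S assume "S \<in> {(\<lambda>i. i * d) ` {..<k}}"
  then have S: "S = (\<lambda>i. i * d) ` {..<k}" by simp
  have "card S = k"
    using assms by (simp add: S card_image inj_on_def)
  moreover have "i * d + Suc d \<le> Suc (k * d)" if "i < k" for i
    using that mult_le_mono1[of "Suc i" k d] by simp
  moreover have "\<not> splits (Suc d) S l" if l: "0 < l" "l < Suc (k * d)" for l
  proof -
    \<comment> \<open>The tile that contains the cut \<open>l\<close>; cut \<open>l\<close> is cell
      \<open>l - 1\<close>.\<close>
    define i where "i = (l - 1) div d"
    have "i < k" using l assms by (simp add: i_def less_mult_imp_div_less)
    moreover have "i * d \<le> l - 1" "l - 1 < i * d + d"
      using assms div_mult_mod_eq[of "l - 1" d] mod_less_divisor[of d "l - 1"]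
      unfolding i_def by linarith+
    ultimately show ?thesis using l by (force simp: splits_def S)
  qed
  ultimately show "S \<in> clusters (Suc d) (Suc (k * d)) k"
    by (auto simp: clusters_def placements_def S)
qed

section \<open>Upper bound from a long increasing chain\<close>

text \<open>Such a word is determined by its entries off the chain, since the remaining values must
  appear along \<open>qs\<close> in increasing order. The number of lists of distinct values off the
  chain is \<open>fact n / fact (length qs)\<close>.\<close>

lemma card_increasing_words_le:
  assumes "set qs \<subseteq> {..<n}"
  shows "card {w \<in> permutations_of_set {1..n}. sorted_wrt (<) (map ((!) w) qs)} * fact (length qs)
    \<le> fact n" (is "card ?W * _ \<le> _")
proof (cases "?W = {}")
  case True
  then show ?thesis by (simp only: card.empty)
next
  case False
  \<comment> \<open>Any word of the set witnesses that \<open>qs\<close> is distinct.\<close>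
  then obtain w0 where "w0 \<in> ?W" by blast
  then have "sorted_wrt (<) (map ((!) w0) qs)" by simp
  then have "distinct (map ((!) w0) qs)" by (simp only: strict_sorted_iff)
  then have dq: "distinct qs" by (simp add: distinct_map)
  have lq: "length qs \<le> n"
    using card_mono[OF _ assms] distinct_card[OF dq] by simp
  obtain ps where ps: "set ps = {..<n} - set qs" "distinct ps"
    using finite_distinct_list[of "{..<n} - set qs"] by auto
  have lp: "length ps = n - length qs"
    using distinct_card[OF ps(2)] distinct_card[OF dq] assms by (simp add: ps(1) card_Diff_subset)
  have w: "length w = n" "distinct w" "set w = {1..n}" if "w \<in> ?W" for w
    using that by (auto simp: permutations_of_set_def dest: distinct_card)
  let ?L = "{xs. length xs = n - length qs \<and> distinct xs \<and> set xs \<subseteq> {1..n}}"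
  have inj_w: "inj_on ((!) w) {..<n}" if "w \<in> ?W" for w
    using w[OF that] by (auto simp: inj_on_def nth_eq_iff_index_eq)
  have img_w: "(!) w ` {..<n} = {1..n}" if "w \<in> ?W" for w
    using w[OF that] by (auto simp: set_conv_nth)
  have chain_values: "set (map ((!) w) qs) = {1..n} - set (map ((!) w) ps)" if "w \<in> ?W" for w
  proof -
    have "(!) w ` ({..<n} - set ps) = (!) w ` {..<n} - (!) w ` set ps"
      by (rule inj_on_image_set_diff[OF inj_w[OF that]]) (use ps in auto)
    moreover have "{..<n} - set ps = set qs" using ps assms by auto
    ultimately show ?thesis using img_w[OF that] by simp
  qed
  have "inj_on (\<lambda>w. map ((!) w) ps) ?W"
  proof (rule inj_onI)
    fix u v assume u: "u \<in> ?W" and v: "v \<in> ?W" and eq: "map ((!) u) ps = map ((!) v) ps"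
    have sets: "set (map ((!) u) qs) = set (map ((!) v) qs)"
      by (simp only: chain_values[OF u] chain_values[OF v] eq)
    have sorted: "sorted_wrt (<) (map ((!) u) qs)" "sorted_wrt (<) (map ((!) v) qs)"
      using u v by auto
    have "map ((!) u) qs = map ((!) v) qs"
      using sorted sets by (intro sorted_distinct_set_unique) (simp_all only: strict_sorted_iff)
    then have "u ! i = v ! i" if "i < n" for i
      using eq that ps(1) by (cases "i \<in> set qs") auto
    then show "u = v" using w[OF u] w[OF v] by (intro nth_equalityI) auto
  qed
  moreover have "(\<lambda>w. map ((!) w) ps) ` ?W \<subseteq> ?L"
  proof (intro image_subsetI)
    fix u assume u: "u \<in> ?W"
    have sub: "set ps \<subseteq> {..<n}" using ps by auto
    show "map ((!) u) ps \<in> ?L"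
      using lp ps(2) inj_on_subset[OF inj_w[OF u] sub] img_w[OF u] image_mono[OF sub, of "(!) u"]
      by (auto simp: distinct_map)
  qed
  moreover have "finite ?L"
    by (rule finite_subset[OF _ finite_lists_length_eq[of "{1..n}" "n - length qs"]]) auto
  ultimately have "card ?W \<le> card ?L" by (rule card_inj_on_le)
  also have "card ?L = \<Prod>{Suc (length qs)..n}"
    using lq by (subst card_lists_distinct_length_eq) auto
  finally have "card ?W * fact (length qs) \<le> \<Prod>{Suc (length qs)..n} * fact (length qs)"
    by simp
  also have "\<dots> = fact n"
    using lq by (simp add: fact_eq_fact_times[of "length qs" n] mult.commute)
  finally show ?thesis .
qed

lemma perms_position:
  assumes "p \<in> perms m" "v \<in> {1..m}"
  obtains t where "t < m" "p ! t = v"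
proof -
  have "length p = m" "v \<in> set p" using assms by (auto simp: perms_def is_perm_def)
  then show ?thesis using that by (auto simp: in_set_conv_nth)
qed

text \<open>In each copy the entries of ranks \<open>p ! 0\<close> to \<open>p ! e\<close> increase
  from its first position to its last. Consecutive copies share an end, which links these into one
  chain of \<open>k * (p ! e - p ! 0) + 1\<close> entries.\<close>

lemma card_sparse_cluster_le:
  assumes p: "p \<in> perms (Suc e)" and asc: "p ! 0 < p ! e"
  shows "card (marked_words p {1..Suc (k * e)} ((\<lambda>i. i * e) ` {..<k})) * fact (Suc (k * (p ! e - p ! 0)))
    \<le> fact (Suc (k * e))"
proof -
  define a d where "a = p ! 0" and "d = p ! e - p ! 0"
  have lp: "length p = Suc e" and dp: "distinct p" and sp: "set p = {1..Suc e}"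
    using p by (auto simp: perms_def is_perm_def)
  have d: "d > 0" using asc by (simp add: d_def)
  have ab: "1 \<le> a" "a + d \<le> Suc e"
    using nth_mem[of 0 p] nth_mem[of e p] lp sp asc by (auto simp: a_def d_def)
  define pos where "pos v = (SOME t. t < Suc e \<and> p ! t = v)" for v
  have pos: "pos v < Suc e \<and> p ! pos v = v" if "v \<in> {1..Suc e}" for v
    unfolding pos_def by (rule someI_ex) (use perms_position[OF p that] in blast)
  have pos_eq: "pos (p ! t) = t" if "t < Suc e" for t
  proof -
    have "p ! t \<in> {1..Suc e}" using that lp sp nth_mem[of t p] by auto
    then have "pos (p ! t) < Suc e" "p ! pos (p ! t) = p ! t" using pos by auto
    then show ?thesis using dp lp that by (simp add: nth_eq_iff_index_eq)
  qed
  have pos_a: "pos a = 0" and pos_b: "pos (a + d) = e"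
    using pos_eq[of 0] pos_eq[of e] asc by (auto simp: a_def d_def)
  \<comment> \<open>Position of link \<open>c\<close> of the chain: copy \<open>c div d\<close>,
    rank \<open>a + c mod d\<close>.\<close>
  define q where "q c = (c div d) * e + pos (a + c mod d)" for c
  \<comment> \<open>At the end of a copy, rank \<open>a + d\<close> at offset \<open>e\<close> is
    the same position as rank \<open>a\<close> at offset 0 of the next copy.\<close>
  have q_Suc: "q (Suc c) = (c div d) * e + pos (Suc (a + c mod d))" for c
  proof (cases "Suc (c mod d) = d")
    case True
    then have "pos (Suc (a + c mod d)) = e" using pos_b by (metis add_Suc_right)
    then show ?thesis using True pos_a by (simp add: q_def div_Suc mod_Suc)
  next
    case False
    then show ?thesis using d by (simp add: q_def div_Suc mod_Suc)
  qed
  let ?qs = "map q [0..<Suc (k * d)]"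
  \<comment> \<open>The link \<open>c = k * d\<close> would fall into a copy \<open>k\<close>, but
    \<open>pos a = 0\<close> puts it at the final position \<open>k * e\<close>.\<close>
  have bound: "q c \<le> k * e" if "c \<le> k * d" for c
  proof (cases "c = k * d")
    case True
    then show ?thesis using d pos_a by (simp add: q_def)
  next
    case False
    then have "c div d < k" using that by (simp add: less_mult_imp_div_less)
    then have "Suc (c div d) * e \<le> k * e" by (intro mult_le_mono1) simp
    moreover have "pos (a + c mod d) \<le> e"
      using pos[of "a + c mod d"] ab mod_less_divisor[OF d, of c] by simp
    ultimately show ?thesis by (simp add: q_def)
  qed
  have "marked_words p {1..Suc (k * e)} ((\<lambda>i. i * e) ` {..<k})
      \<subseteq> {w \<in> permutations_of_set {1..Suc (k * e)}. sorted_wrt (<) (map ((!) w) ?qs)}" (is "?M \<subseteq> ?W")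
  proof
    fix w assume w: "w \<in> ?M"
    have step: "w ! q c < w ! q (Suc c)" if "c < k * d" for c
    proof -
      have "c div d < k" using that by (simp add: less_mult_imp_div_less)
      then have "(c div d) * e \<in> occurrences p w" using w by (auto simp: marked_words_def)
      moreover have "a + c mod d \<in> {1..Suc e}" "Suc (a + c mod d) \<in> {1..Suc e}"
        using ab mod_less_divisor[OF d, of c] by auto
      then have "pos (a + c mod d) < Suc e" "pos (Suc (a + c mod d)) < Suc e"
        "p ! pos (a + c mod d) < p ! pos (Suc (a + c mod d))"
        using pos by auto
      ultimately show ?thesis
        using lp by (simp add: occurrences_def q_Suc) (simp add: q_def)
    qed
    have "sorted_wrt (<) (map ((!) w) ?qs)"
      by (subst sorted_wrt_iff_nth_Suc_transp)
        (use step in \<open>auto simp: transp_def nth_append simp del: upt_Suc\<close>)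
    then show "w \<in> ?W" using w by (simp only: marked_words_def) blast
  qed
  then have "card ?M * fact (length ?qs) \<le> card ?W * fact (length ?qs)"
    by (intro mult_le_mono1 card_mono) auto
  also have "\<dots> \<le> fact (Suc (k * e))"
    by (rule card_increasing_words_le) (use bound in \<open>auto simp: less_Suc_eq_le\<close>)
  finally show ?thesis by (simp add: d_def)
qed

section \<open>Lower bound from an explicit construction\<close>

text \<open>The entry of rank \<open>v\<close> in the \<open>i\<close>-th of \<open>k\<close> copies of a pattern with end points \<open>a < b\<close>,
  consecutive copies sharing one position. The entries of rank between \<open>a\<close> and \<open>b\<close> form one
  long chain; all entries of lower rank are put below it and all those of higher rank above it, each
  such rank \<open>v\<close> having its own interval of \<open>k\<close> values that the permutation \<open>r v\<close> distributes over the
  copies.\<close>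

definition sparse_value :: "nat \<Rightarrow> nat \<Rightarrow> nat \<Rightarrow> (nat \<Rightarrow> nat list) \<Rightarrow> nat \<Rightarrow> nat \<Rightarrow> nat" where
  "sparse_value a b k r i v =
    (if v < a then (v - 1) * k + r v ! i
     else if v \<le> b then (a - 1) * k + i * (b - a) + (v - a) + 1
     else (a - 1) * k + k * (b - a) + 1 + (v - b - 1) * k + r v ! i)"

text \<open>This makes every copy realize the pattern. Ranks outside the chain own disjoint blocks
  of \<open>k\<close> values, ordered by rank, and the chain lies between the low and the high
  blocks.\<close>

lemma sparse_value_mono:
  assumes r: "\<And>v. v \<in> {u..<a} \<union> {b<..v'} \<Longrightarrow> r v ! i \<in> {1..k}"
    and "0 < u" "u < v'" "i < k" "a \<le> b"
  shows "sparse_value a b k r i u < sparse_value a b k r i v'"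
proof -
  \<comment> \<open>The part of the chain in copy \<open>i\<close> ends below the high
    blocks.\<close>
  have ik: "i * (b - a) + (b - a) \<le> k * (b - a)"
    using \<open>i < k\<close> mult_le_mono1[of "Suc i" k "b - a"] by simp
  consider "v' < a" | "u < a" "a \<le> v'" "v' \<le> b" | "u < a" "b < v'" | "a \<le> u" "v' \<le> b"
    | "a \<le> u" "u \<le> b" "b < v'" | "b < u"
    using assms by linarith
  then show ?thesis
  proof cases
    case 1
    have "(u - 1) * k + k = u * k" using \<open>0 < u\<close> by (cases u) auto
    moreover have "u * k \<le> (v' - 1) * k" using assms(3) by (intro mult_le_mono1) simp
    moreover have "r u ! i \<le> k" "1 \<le> r v' ! i" using r[of u] r[of v'] 1 assms by auto
    ultimately have "(u - 1) * k + r u ! i < (v' - 1) * k + r v' ! i" by linarith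
    then show ?thesis using 1 assms(3) by (simp add: sparse_value_def)
  next
    case 2
    have "(u - 1) * k + k = u * k" using \<open>0 < u\<close> by (cases u) auto
    moreover have "u * k \<le> (a - 1) * k" using 2 by (intro mult_le_mono1) simp
    moreover have "r u ! i \<le> k" using r[of u] 2 by auto
    ultimately have "(u - 1) * k + r u ! i \<le> (a - 1) * k" by linarith
    then show ?thesis using 2 by (simp add: sparse_value_def)
  next
    case 3
    have "(u - 1) * k + k = u * k" using \<open>0 < u\<close> by (cases u) auto
    moreover have "u * k \<le> (a - 1) * k" using 3 by (intro mult_le_mono1) simp
    moreover have "r u ! i \<le> k" using r[of u] 3 by auto
    ultimately have "(u - 1) * k + r u ! i \<le> (a - 1) * k" by linarith
    then show ?thesis using 3 assms(5) by (simp add: sparse_value_def)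
  next
    case 4
    then show ?thesis using assms by (simp add: sparse_value_def)
  next
    case 5
    moreover have "1 \<le> r v' ! i" using r[of v'] 5 by auto
    moreover have "u - a \<le> b - a" using 5 by simp
    ultimately have "i * (b - a) + (u - a) < k * (b - a) + r v' ! i" using ik by linarith
    then show ?thesis using 5 by (simp add: sparse_value_def)
  next
    case 6
    have "(u - b - 1) * k + k = (u - b) * k" using 6 by (cases "u - b") auto
    moreover have "(u - b) * k \<le> (v' - b - 1) * k" using assms(3) by (intro mult_le_mono1) simp
    moreover have "r u ! i \<le> k" "1 \<le> r v' ! i" using r[of u] r[of v'] 6 assms by auto
    ultimately have "(u - b - 1) * k + r u ! i < (v' - b - 1) * k + r v' ! i" by linarith
    then show ?thesis using 6 assms(3,5) by (simp add: sparse_value_def)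
  qed
qed

text \<open>Each of the \<open>e - (p ! e - p ! 0)\<close> ranks outside the chain receives its own
  permutation of the \<open>k\<close> copies, and different families of permutations give different
  words.\<close>

lemma card_sparse_cluster_ge:
  assumes p: "p \<in> perms (Suc e)" and asc: "p ! 0 < p ! e" and "k > 0"
  shows "fact k ^ (e - (p ! e - p ! 0))
    \<le> card (marked_words p {1..Suc (k * e)} ((\<lambda>i. i * e) ` {..<k}))"
proof -
  define a b where "a = p ! 0" and "b = p ! e"
  have lp: "length p = Suc e" and sp: "set p = {1..Suc e}"
    using p by (auto simp: perms_def is_perm_def)
  have p_range: "p ! t \<in> {1..Suc e}" if "t \<le> e" for t
    using that lp sp nth_mem[of t p] by auto
  have ab: "1 \<le> a" "a < b" "b \<le> Suc e"
    using p_range[of 0] p_range[of e] asc by (auto simp: a_def b_def)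
  have e: "e > 0" using asc by (cases e) auto
  define J where "J = {1..Suc e} - {a..b}"
  define R where "R = (\<Pi>\<^sub>E v\<in>J. permutations_of_set {1..k})"
  define val where "val = sparse_value a b k"
  define word where "word r = map (\<lambda>x. val r (x div e) (p ! (x mod e))) [0..<Suc (k * e)]" for r
  have cardR: "card R = fact k ^ (e - (b - a))"
  proof -
    have "card J = e - (b - a)"
      unfolding J_def using ab by (subst card_Diff_subset) auto
    then show ?thesis unfolding R_def by (subst card_PiE) (auto simp: J_def)
  qed
  have r_perm: "length (r v) = k" "set (r v) = {1..k}" if "r \<in> R" "v \<in> J" for r v
    using that by (auto simp: R_def permutations_of_set_def dest!: PiE_mem distinct_card)
  have r_range: "r v ! i \<in> {1..k}" if "r \<in> R" "v \<in> J" "i < k" for r v i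
    using r_perm[OF that(1,2)] that(3) nth_mem[of i "r v"] by auto
  have word_len: "length (word r) = Suc (k * e)" for r
    by (simp add: word_def)
  have block_le: "i * e + t \<le> k * e" if "i < k" "t \<le> e" for i t
    using mult_le_mono1[of "Suc i" k e] that by simp
  \<comment> \<open>Offset \<open>e\<close> is stored as offset 0 of the next copy; rank
    \<open>b\<close> in copy \<open>i\<close> and rank \<open>a\<close> in copy \<open>i + 1\<close>
    have the same value.\<close>
  have word_nth: "word r ! (i * e + t) = val r i (p ! t)" if "i < k" "t \<le> e" for r i t
  proof (cases "t = e")
    case True
    have "word r ! (i * e + t) = val r (Suc i) a"
      using True e block_le[OF that] by (simp add: word_def a_def del: upt_Suc)
    also have "\<dots> = val r i b"
      using ab by (simp add: val_def sparse_value_def)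
    finally show ?thesis using True by (simp add: b_def)
  next
    case False
    then show ?thesis using that block_le[OF that] by (simp add: word_def del: upt_Suc)
  qed
  \<comment> \<open>Division assigns the last position to copy \<open>k\<close>, but its rank is
    \<open>a\<close>, so no entry of a permutation is read. It carries the top of the chain.\<close>
  have word_last: "word r ! (k * e) = (a - 1) * k + k * (b - a) + 1" for r
    using e ab by (simp add: word_def val_def sparse_value_def a_def[symmetric] del: upt_Suc)
  have mono: "val r i u < val r i v" if "r \<in> R" "i < k" "u \<in> {1..Suc e}" "v \<in> {1..Suc e}" "u < v"
    for r i u v
    unfolding val_def using that ab
    by (intro sparse_value_mono r_range) (auto simp: J_def)
  have hit: "val r i v \<in> set (word r)" if i: "i < k" and v: "v \<in> {1..Suc e}" for r i v
  proof -
    obtain t where "t < Suc e" "p ! t = v" using perms_position[OF p v] .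
    then show ?thesis
      using word_nth[OF i, of t r] block_le[OF i, of t] word_len[of r]
      by (auto simp: in_set_conv_nth intro!: exI[of _ "i * e + t"])
  qed
  \<comment> \<open>Division by \<open>k\<close> yields the block, and the permutation of that block
    takes the required remainder in some copy.\<close>
  have row: "\<exists>c<g. \<exists>i<k. y = c * k + r (h c) ! i"
    if r: "r \<in> R" and y: "y \<in> {1..g * k}" and h: "\<And>c. c < g \<Longrightarrow> h c \<in> J" for r y g h
  proof -
    define c where "c = (y - 1) div k"
    have c: "c < g" using y by (auto simp: c_def intro!: less_mult_imp_div_less)
    have "Suc ((y - 1) mod k) \<in> set (r (h c))"
      using r_perm[OF r h[OF c]] \<open>k > 0\<close> by (simp add: Suc_le_eq)
    then obtain i where "i < k" "r (h c) ! i = Suc ((y - 1) mod k)"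
      using r_perm(1)[OF r h[OF c]] by (auto simp: in_set_conv_nth)
    moreover have "y = c * k + Suc ((y - 1) mod k)"
      using y div_mult_mod_eq[of "y - 1" k] by (simp add: c_def)
    ultimately show ?thesis using c by metis
  qed
  \<comment> \<open>Surjectivity suffices: the word has as many positions as there are values, so it
    is then also distinct.\<close>
  have word_onto: "{1..Suc (k * e)} \<subseteq> set (word r)" if r: "r \<in> R" for r
  proof
    fix y assume y: "y \<in> {1..Suc (k * e)}"
    define lo where "lo = (a - 1) * k + k * (b - a) + 1"
    have total: "Suc (k * e) = lo + (Suc e - b) * k"
    proof -
      have "e = (a - 1) + (b - a) + (Suc e - b)" using ab by simp
      then have "k * e = k * ((a - 1) + (b - a) + (Suc e - b))" by simp
      then show ?thesis by (simp add: lo_def algebra_simps)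
    qed
    consider "y \<le> (a - 1) * k" | "(a - 1) * k < y" "y < lo" | "y = lo" | "lo < y"
      by linarith
    then show "y \<in> set (word r)"
    proof cases
      case 1
      have "\<exists>c<a - 1. \<exists>i<k. y = c * k + r (Suc c) ! i"
        using 1 y ab by (intro row[OF r]) (auto simp: J_def)
      then obtain c i where c: "c < a - 1" "i < k" "y = c * k + r (Suc c) ! i" by blast
      then have "Suc c < a" by simp
      then have "val r i (Suc c) = y" using c(3) by (simp add: val_def sparse_value_def)
      then show ?thesis using hit[of i "Suc c" r] c ab by auto
    next
      case 2
      \<comment> \<open>Offset inside the chain; dividing by \<open>b - a\<close> gives the copy and
        the rank above \<open>a\<close>.\<close>
      define c where "c = y - (a - 1) * k - 1"
      have "c < k * (b - a)" using 2 by (simp add: c_def lo_def)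
      then have i: "c div (b - a) < k" by (simp add: less_mult_imp_div_less)
      have "c mod (b - a) < b - a" using ab by simp
      then have md: "a + c mod (b - a) \<le> b" by linarith
      have "val r (c div (b - a)) (a + c mod (b - a))
          = (a - 1) * k + (c div (b - a) * (b - a) + c mod (b - a)) + 1"
        using md by (simp add: val_def sparse_value_def)
      also have "\<dots> = y" unfolding div_mult_mod_eq using 2 by (simp add: c_def)
      finally have "val r (c div (b - a)) (a + c mod (b - a)) = y" .
      then show ?thesis using hit[OF i, of "a + c mod (b - a)" r] md ab by auto
    next
      case 3
      then show ?thesis using word_last[of r] word_len[of r] nth_mem[of "k * e" "word r"]
        by (simp add: lo_def)
    next
      case 4
      have "y - lo \<in> {1..(Suc e - b) * k}" using 4 y total by auto
      then have "\<exists>c<Suc e - b. \<exists>i<k. y - lo = c * k + r (Suc (b + c)) ! i"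
        by (intro row[OF r]) (auto simp: J_def)
      then obtain c i where c: "c < Suc e - b" "i < k" "y - lo = c * k + r (Suc (b + c)) ! i"
        by blast
      then have "val r i (Suc (b + c)) = y"
        using 4 ab by (simp add: val_def sparse_value_def lo_def)
      then show ?thesis using hit[of i "Suc (b + c)" r] c by auto
    qed
  qed
  have "word r \<in> marked_words p {1..Suc (k * e)} ((\<lambda>i. i * e) ` {..<k})" if r: "r \<in> R" for r
  proof -
    have "card (set (word r)) \<le> Suc (k * e)" using card_length[of "word r"] word_len by simp
    then have set_word: "set (word r) = {1..Suc (k * e)}"
      using word_onto[OF r] by (intro card_seteq[symmetric]) auto
    then have "distinct (word r)" by (intro card_distinct) (simp add: word_len)
    moreover have "i * e \<in> occurrences p (word r)" if i: "i < k" for i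
    proof -
      have "val r i (p ! x) < val r i (p ! y) \<longleftrightarrow> p ! x < p ! y" if "x \<le> e" "y \<le> e" for x y
        using mono[OF r i p_range[OF that(1)] p_range[OF that(2)]]
          mono[OF r i p_range[OF that(2)] p_range[OF that(1)]]
        by (metis less_asym linorder_less_linear less_irrefl)
      then show ?thesis
        using block_le[OF i, of e] word_nth[OF i]
        by (simp add: occurrences_def lp word_len less_Suc_eq_le)
    qed
    ultimately show ?thesis
      using set_word by (auto simp: marked_words_def permutations_of_set_def)
  qed
  then have "word ` R \<subseteq> marked_words p {1..Suc (k * e)} ((\<lambda>i. i * e) ` {..<k})" by blast
  moreover have "inj_on word R"
  proof (rule inj_onI)
    fix r s assume r: "r \<in> R" and s: "s \<in> R" and eq: "word r = word s"
    have "r v = s v" if v: "v \<in> J" for v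
    proof (rule nth_equalityI)
      show "length (r v) = length (s v)" using r_perm(1) r s v by simp
      fix i assume "i < length (r v)"
      then have i: "i < k" using r_perm(1) r v by simp
      obtain t where t: "t < Suc e" "p ! t = v"
        using perms_position[OF p] v by (auto simp: J_def)
      then have "val r i v = val s i v"
        using word_nth[OF i, of t r] word_nth[OF i, of t s] eq by simp
      then show "r v ! i = s v ! i"
        using v by (auto simp: val_def sparse_value_def J_def split: if_splits)
    qed
    then show "r = s" using r s unfolding R_def by (intro PiE_ext) auto
  qed
  ultimately have "card R \<le> card (marked_words p {1..Suc (k * e)} ((\<lambda>i. i * e) ` {..<k}))"
    by (intro card_inj_on_le[of word]) (simp_all add: finite_marked_words)
  then show ?thesis by (simp add: cardR a_def b_def)
qed

section \<open>Factorial estimates\<close>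

text \<open>The quotient of the factorials is a product of \<open>r\<close> factors, each at least
  \<open>m\<close>.\<close>

lemma power_mult_fact_le_fact: "m ^ r * fact m \<le> (fact (m + r) :: nat)"
proof (induction r)
  case (Suc r)
  have "m ^ Suc r * fact m = m * (m ^ r * fact m)" by simp
  also have "\<dots> \<le> Suc (m + r) * fact (m + r)" using Suc by (intro mult_le_mono) auto
  finally show ?case by simp
qed simp

text \<open>The same \<open>r\<close> factors are each at most \<open>m + r\<close>.\<close>

lemma fact_le_power_mult_fact: "(fact (m + r) :: nat) \<le> (m + r) ^ r * fact m"
proof (induction r)
  case (Suc r)
  have "(fact (m + Suc r) :: nat) = Suc (m + r) * fact (m + r)" by simp
  also have "\<dots> \<le> Suc (m + r) * ((m + r) ^ r * fact m)" using Suc by (rule mult_le_mono2)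
  also have "\<dots> \<le> Suc (m + r) * (Suc (m + r) ^ r * fact m)"
    by (intro mult_le_mono2 mult_le_mono1 power_mono) auto
  finally show ?case by (simp only: add_Suc_right power_Suc mult.assoc)
qed simp

text \<open>A weak form of Stirling's formula, from bounding the central binomial coefficient by
  \<open>4 ^ k\<close>.\<close>

lemma power_self_le_fact: "k ^ k \<le> 4 ^ k * (fact k :: nat)"
proof -
  have "k ^ k * fact k \<le> (fact (k + k) :: nat)" by (rule power_mult_fact_le_fact)
  also have "\<dots> = fact k * fact k * ((k + k) choose k)"
    using binomial_fact_lemma[of k "k + k"] by simp
  also have "\<dots> \<le> fact k * fact k * 2 ^ (k + k)"
    using binomial_le_pow2[of "k + k" k] by (intro mult_le_mono2)
  also have "(2::nat) ^ (k + k) = 4 ^ k" by (simp add: power_add power_mult_distrib[symmetric])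
  finally have "k ^ k * fact k \<le> (4 ^ k * fact k) * fact k" by (simp add: mult_ac)
  then show ?thesis by (simp add: mult_le_cancel2)
qed

text \<open>With \<open>q = e - d - 1\<close>, the quotient of the two outer factorials is at most
  \<open>(k * (e + 1)) ^ (k * q)\<close>, whereas \<open>fact k ^ (q + 1)\<close> is
  \<open>k ^ (k * (q + 1))\<close> up to an exponential factor. The spare \<open>k ^ k\<close> wins
  for large \<open>k\<close>.\<close>

lemma fact_growth:
  assumes "d < d'" "d' \<le> e"
  shows "\<exists>k>0. fact (Suc (k * e)) < fact k ^ (e - d) * (fact (Suc (k * d')) :: nat)"
proof -
  define q where "q = e - d - 1"
  have q: "e - d = Suc q" using assms by (simp add: q_def)
  \<comment> \<open>Chosen to exceed the base of all exponential factors that arise.\<close>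
  define k where "k = Suc (4 ^ Suc q * Suc e ^ q)"
  have "k > 0" by (simp add: k_def)
  have eq: "Suc (k * e) = Suc (k * d') + k * (e - d')"
    using assms(2) by (simp add: add_mult_distrib2[symmetric])
  have "(fact (Suc (k * e)) :: nat) \<le> Suc (k * e) ^ (k * (e - d')) * fact (Suc (k * d'))"
    unfolding eq by (rule fact_le_power_mult_fact)
  also have "\<dots> \<le> (k * Suc e) ^ (k * q) * fact (Suc (k * d'))"
  proof (rule mult_le_mono1)
    have "Suc (k * e) ^ (k * (e - d')) \<le> (k * Suc e) ^ (k * (e - d'))"
      using \<open>k > 0\<close> by (intro power_mono) auto
    also have "\<dots> \<le> (k * Suc e) ^ (k * q)"
      using \<open>k > 0\<close> assms by (intro power_increasing mult_le_mono2) (auto simp: q_def)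
    finally show "Suc (k * e) ^ (k * (e - d')) \<le> (k * Suc e) ^ (k * q)" .
  qed
  also have "\<dots> < fact k ^ Suc q * fact (Suc (k * d'))"
  proof -
    \<comment> \<open>First compare the bases, then raise to the power \<open>k\<close> and replace
      \<open>k ^ k\<close> by \<open>4 ^ k * fact k\<close>.\<close>
    have "4 ^ Suc q * (k * Suc e) ^ q = (4 ^ Suc q * Suc e ^ q) * k ^ q"
      by (simp only: power_mult_distrib mult_ac)
    also have "\<dots> < k * k ^ q" using \<open>k > 0\<close> by (intro mult_strict_right_mono) (auto simp: k_def)
    finally have "(4 ^ Suc q * (k * Suc e) ^ q) ^ k < (k ^ Suc q) ^ k"
      using \<open>k > 0\<close> by (intro power_strict_mono) auto
    also have "(k ^ Suc q) ^ k = (k ^ k) ^ Suc q" by (simp only: power_mult[symmetric] mult.commute)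
    also have "\<dots> \<le> (4 ^ k * fact k) ^ Suc q" using power_self_le_fact by (intro power_mono) auto
    also have "\<dots> = (4 ^ Suc q) ^ k * fact k ^ Suc q"
      by (simp only: power_mult_distrib power_mult[symmetric] mult.commute)
    finally have "(4 ^ Suc q) ^ k * (k * Suc e) ^ (k * q) < (4 ^ Suc q) ^ k * fact k ^ Suc q"
      by (simp only: power_mult_distrib power_mult[symmetric] mult.commute)
    then have "(k * Suc e) ^ (k * q) < fact k ^ Suc q" by (simp only: mult_less_cancel1)
    then show ?thesis by (intro mult_strict_right_mono) auto
  qed
  finally show ?thesis using \<open>k > 0\<close> q by auto
qed

section \<open>Comparison of two equivalent patterns\<close>

text \<open>Otherwise, for a suitable \<open>k\<close>, the lower bound for \<open>pi\<close>
  exceeds the upper bound for \<open>tau\<close>, although both bound the same number. Exchanging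
  the patterns gives the reverse inequality.\<close>

lemma cWilf_end_difference_le:
  fixes pi tau :: "nat list"
  assumes pi: "pi \<in> perms (Suc e)" "pi ! 0 < pi ! e"
    and tau: "tau \<in> perms (Suc e)" "tau ! 0 < tau ! e"
    and eqv: "strongly_cWilf_equiv pi tau"
  shows "tau ! e - tau ! 0 \<le> pi ! e - pi ! 0"
proof (rule ccontr)
  assume less: "\<not> ?thesis"
  have len: "length pi = Suc e" "length tau = Suc e" and sets: "set tau = {1..Suc e}"
    using pi(1) tau(1) by (auto simp: perms_def is_perm_def)
  have e: "e > 0" using pi(2) by (cases e) auto
  have "tau ! e - tau ! 0 \<le> e"
    using nth_mem[of 0 tau] nth_mem[of e tau] len sets by auto
  then obtain k where k: "k > 0" "fact (Suc (k * e))
      < fact k ^ (e - (pi ! e - pi ! 0)) * (fact (Suc (k * (tau ! e - tau ! 0))) :: nat)"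
    using fact_growth[of "pi ! e - pi ! 0" "tau ! e - tau ! 0" e] less by auto
  let ?S = "(\<lambda>i. i * e) ` {..<k}"
  have "marked_total pi n j = marked_total tau n j" for n j
    using eqv pi(1) tau(1)
    by (simp add: marked_total_eq_sum_binomial[of "Suc e"] strongly_cWilf_equiv_def)
  then have "cluster_total pi (Suc (k * e)) k = cluster_total tau (Suc (k * e)) k"
    by (intro cluster_total_cong) (simp_all add: len)
  \<comment> \<open>The set \<open>?S\<close> is the only cluster of this size, so each total is a
    single summand.\<close>
  then have "card (marked_words pi {1..Suc (k * e)} ?S) = card (marked_words tau {1..Suc (k * e)} ?S)"
    by (simp add: cluster_total_def len clusters_sparse[OF e])
  then have "fact k ^ (e - (pi ! e - pi ! 0)) \<le> card (marked_words tau {1..Suc (k * e)} ?S)"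
    using card_sparse_cluster_ge[OF pi k(1)] by simp
  then have "fact k ^ (e - (pi ! e - pi ! 0)) * fact (Suc (k * (tau ! e - tau ! 0)))
      \<le> card (marked_words tau {1..Suc (k * e)} ?S) * fact (Suc (k * (tau ! e - tau ! 0)))"
    by (rule mult_le_mono1)
  also have "\<dots> \<le> fact (Suc (k * e))" by (rule card_sparse_cluster_le[OF tau])
  finally show False using k(2) by simp
qed

theorem theorem1p9:
  fixes pi tau :: "nat list" and m :: nat
  assumes "pi \<in> perms m" and "tau \<in> perms m"
    and "standard_form pi" and "standard_form tau"
    and "strongly_cWilf_equiv pi tau"
  shows "int (pi ! (m - 1)) - int (pi ! 0) = int (tau ! (m - 1)) - int (tau ! 0)"
proof -
  have len: "length pi = m" "length tau = m"
    using assms(1,2) by (auto simp: perms_def is_perm_def)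
  show ?thesis
  proof (cases m)
    case 0
    then show ?thesis using len by simp
  next
    case (Suc e)
    then have ne: "pi \<noteq> []" "tau \<noteq> []" using len by auto
    have asc: "pi ! 0 < pi ! e" "tau ! 0 < tau ! e"
      using assms(3,4) len Suc ne by (auto simp: standard_form_def hd_conv_nth last_conv_nth)
    have "strongly_cWilf_equiv tau pi"
      using assms(5) by (simp add: strongly_cWilf_equiv_def)
    then have "pi ! e - pi ! 0 = tau ! e - tau ! 0"
      using assms(1,2,5) asc unfolding Suc
      by (intro antisym cWilf_end_difference_le)
    \<comment> \<open>The ascents make the truncated differences agree with the integer
      ones.\<close>
    then show ?thesis using asc Suc by simp
  qed
qed

end
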